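(* Let $\mathcal{I} = ((\mathcal{F}_i)_{i=1}^n,\pi)$ be an instance of the hiring problem, let $\mathrm{OPTOffIIF}$ be an optimal (expected-value-maximizing) offline IIF algorithm for $\mathcal{I}$, and let $\mathrm{OPTOnIIF}$ be an optimal IIF stopping rule for $\mathcal{I}$. Then \[ \mathbb{E}[\mathrm{OPTOnIIF}] \ge \tfrac12\,\mathbb{E}[\mathrm{OPTOffIIF}]. \] Moreover the inequality is tight: for every $c>1/2$ there is an instance for which $\mathbb{E}[\mathrm{OPTOnIIF}] < c\,\mathbb{E}[\mathrm{OPTOffIIF}]$.
   Context: Hiring problem: $n$ candidates; candidate $i$ has a nonnegative random value $X_i\sim\mathcal{F}_i$, the $X_i$ independent, each $\mathcal{F}_i$ discrete; $f_i(x)=\Pr[X_i=x]$, $\mathcal{S}=\bigcup_i\{x:f_i(x)>0\}$. An instance with arrival ordering is $((\mathcal{F}_i)_{i=1}^n,\pi)$ with $\pi$ a permutation of $[n]$: at step $t$ candidate $\pi(t)$ arrives, $X_{\pi(t)}$ is revealed, and the decision maker either hires $\pi(t)$ (and stops) or rejects it irrevocably. A stopping rule is a possibly randomized procedure knowing $n$, the $\mathcal{F}_i$, $\pi$, deciding at step $t$ using only $X_{\pi(1)},\dots,X_{\pi(t)}$ (and own randomness), hiring at most one candidate. An offline algorithm sees all of $X_1,\dots,X_n$ and then (possibly randomly) hires at most one candidate. An algorithm's name also denotes the value of the hired candidate ($0$ if none). An (online or offline) algorithm is IIF with probability function $p:\mathcal{S}\to[0,1]$ if $\Pr[\mathrm{ALG}\text{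 hires } i\mid X_i=x]=p(x)$ for all $i\in[n]$, $x\in\mathcal{S}$; IIF means IIF with some such $p$. *)

theory Defs
  imports "HOL-Probability.Probability" "HOL-Combinatorics.Permutations"
begin

type_synonym profile = "nat \<Rightarrow> real"

text \<open>
  Candidates and time steps are numbered \<open>1..n\<close>; a discrete distribution is a pmf
  (possibly with countably infinite support).
\<close>

definition hiring_instance :: "nat \<Rightarrow> (nat \<Rightarrow> real pmf) \<Rightarrow> (nat \<Rightarrow> nat) \<Rightarrow> bool" where
  "hiring_instance n F \<pi> \<longleftrightarrow>
     (\<forall>i\<in>{1..n}. set_pmf (F i) \<subseteq> {0..}) \<and> \<pi> permutes {1..n}"

definition value_set :: "nat \<Rightarrow> (nat \<Rightarrow> real pmf) \<Rightarrow> real set" where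
  "value_set n F = (\<Union>i\<in>{1..n}. {x. pmf (F i) x > 0})"

text \<open>
  An algorithm, online or offline, induces a kernel from value profiles to the (random) hired
  candidate, \<open>None\<close> meaning that nobody is hired.
\<close>

type_synonym algorithm = "profile \<Rightarrow> nat option pmf"

definition joint :: "nat \<Rightarrow> (nat \<Rightarrow> real pmf) \<Rightarrow> algorithm \<Rightarrow> (profile \<times> nat option) pmf" where
  "joint n F A =
     bind_pmf (Pi_pmf {1..n} 0 F) (\<lambda>X. map_pmf (\<lambda>h. (X, h)) (A X))"

fun hired_value :: "profile \<Rightarrow> nat option \<Rightarrow> real" where
  "hired_value X None = 0"
| "hired_value X (Some i) = X i"

text \<open>Values are nonnegative; the expectation is taken in \<open>[0, \<infinity>]\<close> because a mean may be infinite.\<close>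

definition expected_value :: "nat \<Rightarrow> (nat \<Rightarrow> real pmf) \<Rightarrow> algorithm \<Rightarrow> ennreal" where
  "expected_value n F A =
     (\<integral>\<^sup>+ (X, h). ennreal (hired_value X h) \<partial>measure_pmf (joint n F A))"

text \<open>
  The conditional probability given \<open>X\<^sub>i = x\<close> is only meaningful when \<open>f\<^sub>i(x) > 0\<close>; without
  that guard the convention \<open>0 / 0 = 0\<close> in \<^const>\<open>cond_prob\<close> would force \<open>p x = 0\<close> at every value
  missing from the support of some candidate.
\<close>

definition IIF_with :: "nat \<Rightarrow> (nat \<Rightarrow> real pmf) \<Rightarrow> algorithm \<Rightarrow> (real \<Rightarrow> real) \<Rightarrow> bool" where
  "IIF_with n F A p \<longleftrightarrow>
     (\<forall>x\<in>value_set n F. p x \<in> {0..1}) \<and>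
     (\<forall>i\<in>{1..n}. \<forall>x\<in>value_set n F. pmf (F i) x > 0 \<longrightarrow>
        \<P>((X, h) in measure_pmf (joint n F A). h = Some i \<bar> X i = x) = p x)"

definition IIF :: "nat \<Rightarrow> (nat \<Rightarrow> real pmf) \<Rightarrow> algorithm \<Rightarrow> bool" where
  "IIF n F A \<longleftrightarrow> (\<exists>p. IIF_with n F A p)"

definition offline_algorithm :: "nat \<Rightarrow> algorithm \<Rightarrow> bool" where
  "offline_algorithm n A \<longleftrightarrow> (\<forall>X. set_pmf (A X) \<subseteq> insert None (Some ` {1..n}))"

text \<open>
  A randomized stopping rule maps the list of values revealed so far, most recent last, to the
  random decision (\<open>True\<close> = hire) at the current step. The list determines the current step, and
  the decision is only consulted if all previous candidates were rejected, so correlating the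
  coin flips of different steps would give no additional generality.
\<close>

type_synonym stopping_rule = "real list \<Rightarrow> bool pmf"

fun run_rule :: "stopping_rule \<Rightarrow> profile \<Rightarrow> real list \<Rightarrow> nat list \<Rightarrow> nat option pmf" where
  "run_rule d X hist [] = return_pmf None"
| "run_rule d X hist (i # is) =
     bind_pmf (d (hist @ [X i]))
       (\<lambda>hire. if hire then return_pmf (Some i) else run_rule d X (hist @ [X i]) is)"

definition online_algorithm :: "nat \<Rightarrow> (nat \<Rightarrow> nat) \<Rightarrow> stopping_rule \<Rightarrow> algorithm" where
  "online_algorithm n \<pi> d = (\<lambda>X. run_rule d X [] (map \<pi> [1..<Suc n]))"

definition optimal_offline_IIF :: "nat \<Rightarrow> (nat \<Rightarrow> real pmf) \<Rightarrow> algorithm \<Rightarrow> bool" where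
  "optimal_offline_IIF n F A \<longleftrightarrow>
     offline_algorithm n A \<and> IIF n F A \<and>
     (\<forall>B. offline_algorithm n B \<and> IIF n F B \<longrightarrow> expected_value n F B \<le> expected_value n F A)"

definition optimal_online_IIF ::
    "nat \<Rightarrow> (nat \<Rightarrow> real pmf) \<Rightarrow> (nat \<Rightarrow> nat) \<Rightarrow> stopping_rule \<Rightarrow> bool" where
  "optimal_online_IIF n F \<pi> d \<longleftrightarrow>
     IIF n F (online_algorithm n \<pi> d) \<and>
     (\<forall>e. IIF n F (online_algorithm n \<pi> e) \<longrightarrow>
        expected_value n F (online_algorithm n \<pi> e)
          \<le> expected_value n F (online_algorithm n \<pi> d))"

end

theory Submission imports Defs begin

text \<open>
  An IIF algorithm with probability function \<open>p\<close> has value \<open>\<Sum>i. E[X\<^sub>i p(X\<^sub>i)]\<close> and hires somebody with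
  probability \<open>\<Sum>i. E[p(X\<^sub>i)] \<le> 1\<close>. Hence a stopping rule with probability function \<open>q = p / 2\<close> would
  still be undecided at every step \<open>t\<close> with probability \<open>s\<^sub>t \<ge> 1/2\<close>, and it exists: since the event of
  being undecided is independent of the arriving value \<open>x\<close>, hiring with probability \<open>q(x) / s\<^sub>t \<le> 1\<close>
  works. For tightness let the first candidate be worth \<open>1\<close>, and the second \<open>1 / \<epsilon>\<close> with
  probability \<open>\<epsilon>\<close> and \<open>0\<close> otherwise: no stopping rule beats \<open>1\<close>, while taking the better candidate
  is IIF and yields \<open>2 - \<epsilon>\<close>.
\<close>

section \<open>Hiring probabilities, and the value as a linear function of them\<close>

lemma prob_joint_value:
  assumes "i \<in> {1..n}"
  shows "measure_pmf.prob (joint n F A) {(X, h). X i = x} = pmf (F i) x"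
proof -
  have "map_pmf (\<lambda>(X, h). X i) (joint n F A) = map_pmf (\<lambda>X. X i) (Pi_pmf {1..n} 0 F)"
    by (simp add: joint_def map_bind_pmf pmf.map_comp o_def flip: map_pmf_def)
  also have "\<dots> = F i"
    using assms by (simp add: Pi_pmf_component)
  finally have "pmf (F i) x = pmf (map_pmf (\<lambda>(X, h). X i) (joint n F A)) x"
    by simp
  also have "\<dots> = measure_pmf.prob (joint n F A) {(X, h). X i = x}"
    by (subst pmf_map) (auto intro!: arg_cong[where f = "measure_pmf.prob _"])
  finally show ?thesis by simp
qed

lemma cond_prob_hire:
  assumes "i \<in> {1..n}"
  shows "\<P>((X, h) in measure_pmf (joint n F A). h = Some i \<bar> X i = x) =
    measure_pmf.prob (joint n F A) {(X, h). h = Some i \<and> X i = x} / pmf (F i) x"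
proof -
  have "{z. (case z of (X, h) \<Rightarrow> h = Some i) \<and> (case z of (X, h) \<Rightarrow> X i = x)} =
      {(X, h). h = Some i \<and> X i = x}"
    by auto
  then show ?thesis
    using prob_joint_value[OF assms, of F A x] by (simp add: cond_prob_def)
qed

text \<open>Multiplying out the conditional probability turns IIF into an identity valid for every
  real \<open>x\<close>: where \<open>pmf (F i) x = 0\<close>, the left event lies inside the null
  event \<open>X i = x\<close>, so both sides vanish.\<close>

lemma IIF_with_prob_hire:
  assumes "IIF_with n F A p" "i \<in> {1..n}"
  shows "measure_pmf.prob (joint n F A) {(X, h). h = Some i \<and> X i = x} = pmf (F i) x * p x"
proof (cases "pmf (F i) x > 0")
  case True
  then have "x \<in> value_set n F"
    using assms(2) by (auto simp: value_set_def)
  then have "\<P>((X, h) in measure_pmf (joint n F A). h = Some i \<bar> X i = x) = p x"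
    using assms True by (auto simp: IIF_with_def)
  with True show ?thesis
    by (simp add: cond_prob_hire[OF assms(2)] field_simps)
next
  case False
  then have 0: "pmf (F i) x = 0"
    using pmf_nonneg[of "F i" x] by linarith
  have "measure_pmf.prob (joint n F A) {(X, h). h = Some i \<and> X i = x}
      \<le> measure_pmf.prob (joint n F A) {(X, h). X i = x}"
    by (intro measure_pmf.finite_measure_mono) auto
  with 0 show ?thesis
    using prob_joint_value[OF assms(2), of F A x] by (simp add: measure_le_0_iff)
qed

text \<open>On the part where \<open>h = Some i\<close>, the pair \<open>(h, X i)\<close> has
  density \<open>pmf (F i) x * q x\<close>. The weight \<open>g\<close> is kept general because two
  choices matter: \<open>g = ennreal\<close> gives the value of the algorithm, and the constant
  \<open>1\<close> gives the probability that somebody is hired.\<close>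

lemma nn_integral_joint_hired:
  fixes g :: "real \<Rightarrow> ennreal"
  assumes hire: "\<And>i x. i \<in> {1..n} \<Longrightarrow>
    measure_pmf.prob (joint n F A) {(X, h). h = Some i \<and> X i = x} = pmf (F i) x * q x"
  shows "(\<integral>\<^sup>+ (X, h). (\<Sum>i\<in>{1..n}. indicator {Some i} h * g (X i)) \<partial>measure_pmf (joint n F A)) =
    (\<Sum>i\<in>{1..n}. \<integral>\<^sup>+ x. ennreal (q x) * g x \<partial>measure_pmf (F i))"
proof -
  let ?J = "joint n F A"
  have one: "(\<integral>\<^sup>+ (X, h). indicator {Some i} h * g (X i) \<partial>measure_pmf ?J) =
      (\<integral>\<^sup>+ x. ennreal (q x) * g x \<partial>measure_pmf (F i))" if i: "i \<in> {1..n}" for i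
  proof -
    \<comment> \<open>The summand for \<open>i\<close> depends only on \<open>h\<close> and
      \<open>X i\<close>. Pushing forward to this pair replaces the integral over profiles by a sum
      over pairs, which the indicator cuts down to the slice \<open>Some i\<close>, parametrised by
      \<open>x\<close>.\<close>
    let ?M = "map_pmf (\<lambda>(X, h). (h, X i)) ?J"
    have pmf_M: "pmf ?M (Some i, x) = pmf (F i) x * q x" for x
    proof -
      have "(\<lambda>(X, h). (h, X i)) -` {(Some i, x)} = {(X, h). h = Some i \<and> X i = x}"
        by auto
      then show ?thesis
        using hire[OF i, of x] by (simp add: pmf_map)
    qed
    have "(\<integral>\<^sup>+ (X, h). indicator {Some i} h * g (X i) \<partial>measure_pmf ?J) =
        (\<integral>\<^sup>+ (h, x). indicator {Some i} h * g x \<partial>measure_pmf ?M)"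
      by (simp add: case_prod_unfold)
    also have "\<dots> = (\<integral>\<^sup>+ z. ennreal (pmf ?M z) * (indicator {Some i} (fst z) * g (snd z))
        \<partial>count_space UNIV)"
      by (simp only: nn_integral_measure_pmf case_prod_unfold)
    also have "\<dots> = (\<integral>\<^sup>+ z. ennreal (pmf ?M z) * g (snd z) * indicator (range (Pair (Some i))) z
        \<partial>count_space UNIV)"
      by (intro nn_integral_cong) (auto simp: indicator_def)
    also have "\<dots> = (\<integral>\<^sup>+ z. ennreal (pmf ?M z) * g (snd z) \<partial>count_space (range (Pair (Some i))))"
      by (simp add: nn_integral_count_space_indicator)
    also have "\<dots> = (\<integral>\<^sup>+ x. ennreal (pmf ?M (Some i, x)) * g x \<partial>count_space UNIV)"
      by (subst nn_integral_bij_count_space[symmetric, of "Pair (Some i)" UNIV])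
         (auto simp: bij_betw_def inj_on_def)
    also have "\<dots> = (\<integral>\<^sup>+ x. ennreal (pmf (F i) x) * (ennreal (q x) * g x) \<partial>count_space UNIV)"
      unfolding pmf_M by (simp add: ennreal_mult' mult.assoc)
    also have "\<dots> = (\<integral>\<^sup>+ x. ennreal (q x) * g x \<partial>measure_pmf (F i))"
      by (simp add: nn_integral_measure_pmf)
    finally show ?thesis .
  qed
  have "(\<integral>\<^sup>+ (X, h). (\<Sum>i\<in>{1..n}. indicator {Some i} h * g (X i)) \<partial>measure_pmf ?J) =
      (\<Sum>i\<in>{1..n}. \<integral>\<^sup>+ (X, h). indicator {Some i} h * g (X i) \<partial>measure_pmf ?J)"
    unfolding case_prod_unfold by (rule nn_integral_sum) simp
  also have "\<dots> = (\<Sum>i\<in>{1..n}. \<integral>\<^sup>+ x. ennreal (q x) * g x \<partial>measure_pmf (F i))"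
    by (intro sum.cong refl one)
  finally show ?thesis .
qed

lemma sum_indicator_Some:
  fixes g :: "nat \<Rightarrow> ennreal"
  assumes "h \<in> insert None (Some ` {1..n})"
  shows "(\<Sum>i\<in>{1..n}. indicator {Some i} h * g i) = (case h of None \<Rightarrow> 0 | Some i \<Rightarrow> g i)"
proof (cases h)
  case (Some k)
  have "(\<Sum>i\<in>{1..n}. indicator {Some i} h * g i) = (\<Sum>i\<in>{1..n}. if i = k then g k else 0)"
    using Some by (intro sum.cong) (auto simp: indicator_def)
  with Some assms show ?thesis by (auto)
qed simp

lemma sum_indicator_Some_le_1:
  fixes h :: "nat option"
  shows "(\<Sum>i\<in>{1..n}. indicator {Some i} h * (1 :: ennreal)) \<le> 1"
proof (cases "h \<in> insert None (Some ` {1..n})")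
  case True
  then show ?thesis
    using sum_indicator_Some[OF True, of "\<lambda>_. 1"] by (auto split: option.splits)
next
  case False
  then have "(\<Sum>i\<in>{1..n}. indicator {Some i} h * (1 :: ennreal)) = 0"
    by (intro sum.neutral) (auto simp: indicator_def)
  then show ?thesis by simp
qed

text \<open>The algorithm enters the value only through \<open>q\<close>, and linearly. This is what
  makes offline and online algorithms comparable.\<close>

lemma expected_value_eq_sum:
  assumes "offline_algorithm n A"
    and "\<And>i x. i \<in> {1..n} \<Longrightarrow>
      measure_pmf.prob (joint n F A) {(X, h). h = Some i \<and> X i = x} = pmf (F i) x * q x"
  shows "expected_value n F A = (\<Sum>i\<in>{1..n}. \<integral>\<^sup>+ x. ennreal (q x) * ennreal x \<partial>measure_pmf (F i))"
proof -
  have "expected_value n F A =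
      (\<integral>\<^sup>+ (X, h). (\<Sum>i\<in>{1..n}. indicator {Some i} h * ennreal (X i)) \<partial>measure_pmf (joint n F A))"
    unfolding expected_value_def
  proof (intro nn_integral_cong_AE AE_pmfI)
    fix z assume "z \<in> set_pmf (joint n F A)"
    then obtain X h where z: "z = (X, h)" "h \<in> set_pmf (A X)"
      by (auto simp: joint_def)
    with assms(1) have "h \<in> insert None (Some ` {1..n})"
      by (auto simp: offline_algorithm_def)
    from sum_indicator_Some[OF this, of "\<lambda>i. ennreal (X i)"]
    show "(case z of (X, h) \<Rightarrow> ennreal (hired_value X h)) =
        (case z of (X, h) \<Rightarrow> \<Sum>i\<in>{1..n}. indicator {Some i} h * ennreal (X i))"
      by (auto simp: z split: option.splits)
  qed
  then show ?thesis
    using nn_integral_joint_hired[OF assms(2), where g = ennreal] by simp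
qed

text \<open>The hiring events of different candidates are disjoint, so their probabilities sum to at
  most \<open>1\<close>.\<close>

lemma sum_hire_prob_le_1:
  assumes "\<And>i x. i \<in> {1..n} \<Longrightarrow>
      measure_pmf.prob (joint n F A) {(X, h). h = Some i \<and> X i = x} = pmf (F i) x * q x"
  shows "(\<Sum>i\<in>{1..n}. \<integral>\<^sup>+ x. ennreal (q x) \<partial>measure_pmf (F i)) \<le> 1"
proof -
  have "(\<Sum>i\<in>{1..n}. \<integral>\<^sup>+ x. ennreal (q x) \<partial>measure_pmf (F i)) =
      (\<integral>\<^sup>+ (X, h). (\<Sum>i\<in>{1..n}. indicator {Some i} h * 1) \<partial>measure_pmf (joint n F A))"
    using nn_integral_joint_hired[OF assms, where g = "\<lambda>_. 1"] by simp
  also have "\<dots> \<le> (\<integral>\<^sup>+ z. 1 \<partial>measure_pmf (joint n F A))"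
    unfolding case_prod_unfold by (intro nn_integral_mono sum_indicator_Some_le_1)
  also have "\<dots> = 1" by simp
  finally show ?thesis .
qed

section \<open>Stopping rules with prescribed hiring probabilities\<close>

lemma set_pmf_run_rule: "set_pmf (run_rule d X hist is) \<subseteq> insert None (Some ` set is)"
proof (induction "is" arbitrary: hist)
  case (Cons i "is")
  have "set_pmf (run_rule d X (hist @ [X i]) is) \<subseteq> insert None (Some ` set is)"
    by (rule Cons.IH)
  then show ?case by (auto split: if_splits)
qed simp

text \<open>Makes \<open>expected_value_eq_sum\<close> applicable to stopping rules.\<close>

lemma offline_algorithm_online:
  assumes "\<pi> permutes {1..n}"
  shows "offline_algorithm n (online_algorithm n \<pi> d)"
proof -
  have "set (map \<pi> [1..<Suc n]) = {1..n}"
    using permutes_image[OF assms] by (simp add: atLeastLessThanSuc_atLeastAtMost del: upt_Suc)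
  then show ?thesis
    unfolding offline_algorithm_def online_algorithm_def
    using set_pmf_run_rule by metis
qed

text \<open>The candidate of step \<open>t\<close> is hired exactly when the coins of steps
  \<open>k\<close> to \<open>t - 1\<close> reject and that of step \<open>t\<close> accepts; for a
  fixed profile these coins are independent. Injectivity of \<open>\<pi>\<close> keeps this
  candidate from arriving at any other step.\<close>

lemma pmf_run_rule_bernoulli:
  fixes a :: "nat \<Rightarrow> real \<Rightarrow> real"
  assumes inj: "inj \<pi>"
    and a: "\<And>u x. u \<in> {1..n} \<Longrightarrow> a u x \<in> {0..1}"
    and "1 \<le> k" "k \<le> t" "t \<le> n" "Suc (length hist) = k"
  shows "pmf (run_rule (\<lambda>l. bernoulli_pmf (a (length l) (last l))) X hist (map \<pi> [k..<Suc n]))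
      (Some (\<pi> t)) = (\<Prod>u\<in>{k..<t}. 1 - a u (X (\<pi> u))) * a t (X (\<pi> t))"
  (is "pmf (run_rule ?d _ _ _) _ = _")
  using assms(4,3,6)
\<comment> \<open>The induction runs downwards in the starting step \<open>k\<close>, from
  \<open>k = t\<close>. The invariant \<open>Suc (length hist) = k\<close> makes
  \<open>length l\<close> the current step, because the rule sees the history with the new value
  already appended.\<close>
proof (induction k arbitrary: hist rule: inc_induct)
  case base
  have "\<pi> t \<notin> set (map \<pi> [Suc t..<Suc n])"
    by (auto simp: inj_eq[OF inj] simp del: upt_Suc)
  then have "Some (\<pi> t) \<notin> set_pmf (run_rule ?d X h (map \<pi> [Suc t..<Suc n]))" for h
    using set_pmf_run_rule[of ?d X h "map \<pi> [Suc t..<Suc n]"] by blast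
  then have later: "pmf (run_rule ?d X h (map \<pi> [Suc t..<Suc n])) (Some (\<pi> t)) = 0" for h
    by (simp add: pmf_eq_0_set_pmf)
  have "a t (X (\<pi> t)) \<in> {0..1}"
    using a base \<open>t \<le> n\<close> by simp
  then show ?case
    using base(2) later[of "hist @ [X (\<pi> t)]"]
    by (simp add: upt_conv_Cons[OF le_imp_less_Suc[OF \<open>t \<le> n\<close>]] pmf_bind del: upt_Suc)
next
  case (step k)
  have kn: "k \<le> n" and ne: "\<pi> k \<noteq> \<pi> t"
    using step(2) \<open>t \<le> n\<close> by (auto simp: inj_eq[OF inj])
  have ak: "a k (X (\<pi> k)) \<in> {0..1}"
    using a step(4) kn by simp
  have IH: "pmf (run_rule ?d X (hist @ [X (\<pi> k)]) (map \<pi> [Suc k..<Suc n])) (Some (\<pi> t)) =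
      (\<Prod>u\<in>{Suc k..<t}. 1 - a u (X (\<pi> u))) * a t (X (\<pi> t))"
    using step(5) by (intro step.IH) simp_all
  have "pmf (run_rule ?d X hist (map \<pi> [k..<Suc n])) (Some (\<pi> t)) =
      (1 - a k (X (\<pi> k))) *
        pmf (run_rule ?d X (hist @ [X (\<pi> k)]) (map \<pi> [Suc k..<Suc n])) (Some (\<pi> t))"
    using ne ak step(5) by (simp add: upt_conv_Cons[OF le_imp_less_Suc[OF kn]] pmf_bind del: upt_Suc)
  also have "\<dots> = (\<Prod>u\<in>{k..<t}. 1 - a u (X (\<pi> u))) * a t (X (\<pi> t))"
    unfolding IH using step(2) by (simp add: prod.atLeast_Suc_lessThan)
  finally show ?case .
qed

text \<open>For a fixed profile the probability of the hiring event is a product with one factor per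
  candidate. Independence of the values turns its expectation into a product of expectations: the
  rejections telescope to \<open>s t\<close>, which cancels the denominator in the acceptance
  probability \<open>q x / s t\<close>.\<close>

lemma online_hire_prob:
  fixes q :: "real \<Rightarrow> real"
  assumes perm: "\<pi> permutes {1..n}"
    and q: "\<And>x. q x \<in> {0..1/2}"
    and le: "(\<Sum>i\<in>{1..n}. measure_pmf.expectation (F i) q) \<le> 1 / 2"
  obtains d where "\<And>i x. i \<in> {1..n} \<Longrightarrow>
    measure_pmf.prob (joint n F (online_algorithm n \<pi> d)) {(X, h). h = Some i \<and> X i = x} =
      pmf (F i) x * q x"
proof
  define r where "r u = measure_pmf.expectation (F (\<pi> u)) q" for u
  \<comment> \<open>the probability of still being undecided at step \<open>t\<close>\<close>
  define s where "s t = 1 - (\<Sum>u\<in>{1..<t}. r u)" for t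
  define a where "a t x = q x / s t" for t x
  define d where "d l = bernoulli_pmf (a (length l) (last l))" for l
  have int_q: "integrable (measure_pmf M) q" for M
    by (rule measure_pmf.integrable_const_bound[where B = "1/2"]) (use q in auto)
  have r_nonneg: "r u \<ge> 0" for u
    unfolding r_def using q by (intro integral_nonneg_AE) auto
  have sum_r: "(\<Sum>u\<in>{1..n}. r u) \<le> 1 / 2"
    using le sum.permute[OF perm, of "\<lambda>i. measure_pmf.expectation (F i) q"]
    by (simp add: r_def o_def)
  have s_ge: "s t \<ge> 1 / 2" if "t \<le> Suc n" for t
  proof -
    have "(\<Sum>u\<in>{1..<t}. r u) \<le> (\<Sum>u\<in>{1..n}. r u)"
      using that r_nonneg by (intro sum_mono2) auto
    with sum_r show ?thesis by (simp add: s_def)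
  qed
  have a: "a u x \<in> {0..1}" if "u \<in> {1..n}" for u x
    using s_ge[of u] q[of x] that by (auto simp: a_def field_simps)
  \<comment> \<open>Each factor is \<open>s (Suc u) / s u\<close>, and \<open>s 1 = 1\<close>. So
    \<open>s t\<close> really is the probability that all earlier candidates were rejected.\<close>
  have telescope: "(\<Prod>u\<in>{1..<t}. 1 - r u / s u) = s t" if "1 \<le> t" "t \<le> n" for t
    using that
  proof (induction t rule: dec_induct)
    case base
    then show ?case by (simp add: s_def)
  next
    case (step t)
    then have "s t \<noteq> 0" using s_ge[of t] by auto
    moreover have "s (Suc t) = s t - r t"
      using step by (simp add: s_def)
    ultimately have "s t * (1 - r t / s t) = s (Suc t)"
      by (simp add: right_diff_distrib)
    with step show ?case
      by simp
  qed
  fix i :: nat and x :: real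
  assume "i \<in> {1..n}"
  then obtain t where t: "t \<in> {1..n}" "i = \<pi> t"
    using permutes_image[OF perm] by blast
  \<comment> \<open>\<open>f u\<close> is the contribution of step \<open>u\<close> to the event
    that \<open>i\<close> is hired with value \<open>x\<close>: rejection before step
    \<open>t\<close>, acceptance of the value \<open>x\<close> at step \<open>t\<close>, and the
    constant \<open>1\<close> afterwards, since later arrivals do not influence the event.\<close>
  define f where "f u y = (if u < t then 1 - a u y else if u = t then indicator {x} y * a t y else 1)"
    for u y
  \<comment> \<open>The same factors indexed by candidates instead of steps, because
    \<open>Pi_pmf\<close> is a product over candidates.\<close>
  define f' where "f' j = f (inv \<pi> j)" for j
  have f'_\<pi>: "f' (\<pi> u) = f u" for u
    by (simp add: f'_def permutes_inverses[OF perm])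
  have f_bounds: "f u y \<in> {0..1}" if "u \<in> {1..n}" for u y
    using a[OF that, of y] a[OF t(1), of y] by (auto simp: f_def indicator_def)
  have f'_bounds: "f' j y \<in> {0..1}" if "j \<in> {1..n}" for j y
    using f_bounds permutes_in_image[OF permutes_inv[OF perm]] that by (simp add: f'_def)
  let ?J = "joint n F (online_algorithm n \<pi> d)" and ?P = "Pi_pmf {1..n} 0 F"
  have split: "{1..n} = insert t ({1..<t} \<union> {t<..n})"
    using t by auto
  \<comment> \<open>The operation \<open>g\<close> on factors is general because the splitting is
    applied twice: to the factors evaluated at a profile, and to their expectations.\<close>
  have prod_f: "(\<Prod>u\<in>{1..n}. g u (f u)) = (\<Prod>u\<in>{1..<t}. g u (f u)) * g t (f t)"
    if "\<And>u. u \<in> {t<..n} \<Longrightarrow> g u (f u) = 1" for g :: "nat \<Rightarrow> (real \<Rightarrow> real) \<Rightarrow> real"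
  proof -
    have "(\<Prod>u\<in>{1..n}. g u (f u)) = g t (f t) * (\<Prod>u\<in>{1..<t} \<union> {t<..n}. g u (f u))"
      by (subst split, subst prod.insert) auto
    also have "(\<Prod>u\<in>{1..<t} \<union> {t<..n}. g u (f u)) =
        (\<Prod>u\<in>{1..<t}. g u (f u)) * (\<Prod>u\<in>{t<..n}. g u (f u))"
      by (rule prod.union_disjoint) auto
    finally show ?thesis using that by simp
  qed
  have "measure_pmf.prob ?J {(X, h). h = Some i \<and> X i = x} =
      pmf (map_pmf (\<lambda>(X, h). h = Some i \<and> X i = x) ?J) True"
    by (subst pmf_map) (auto intro!: arg_cong[where f = "measure_pmf.prob _"])
  also have "\<dots> = measure_pmf.expectation ?P (\<lambda>X. pmf (map_pmf (\<lambda>h. h = Some i \<and> X i = x)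
      (online_algorithm n \<pi> d X)) True)"
    by (simp add: joint_def map_bind_pmf pmf_bind pmf.map_comp o_def)
  also have "\<dots> = measure_pmf.expectation ?P
      (\<lambda>X. indicator {x} (X i) * pmf (online_algorithm n \<pi> d X) (Some i))"
  proof (intro Bochner_Integration.integral_cong refl)
    fix X :: profile
    show "pmf (map_pmf (\<lambda>h. h = Some i \<and> X i = x) (online_algorithm n \<pi> d X)) True =
        indicator {x} (X i) * pmf (online_algorithm n \<pi> d X) (Some i)"
      by (subst pmf_map) (auto simp: vimage_def indicator_def measure_pmf_single)
  qed
  also have "\<dots> = measure_pmf.expectation ?P (\<lambda>X. \<Prod>j\<in>{1..n}. f' j (X j))"
  proof (intro Bochner_Integration.integral_cong refl)
    fix X :: profile
    have "pmf (online_algorithm n \<pi> d X) (Some i) =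
        (\<Prod>u\<in>{1..<t}. 1 - a u (X (\<pi> u))) * a t (X (\<pi> t))"
      unfolding online_algorithm_def d_def t(2)
      using t by (intro pmf_run_rule_bernoulli permutes_inj[OF perm] a) auto
    also have "indicator {x} (X i) * \<dots> = (\<Prod>u\<in>{1..n}. f u (X (\<pi> u)))"
      using prod_f[of "\<lambda>u w. w (X (\<pi> u))"] by (simp add: f_def t(2))
    also have "\<dots> = (\<Prod>j\<in>{1..n}. f' j (X j))"
      using prod.permute[OF perm, of "\<lambda>j. f' j (X j)"] by (simp add: f'_\<pi> o_def)
    finally show "indicator {x} (X i) * pmf (online_algorithm n \<pi> d X) (Some i) =
        (\<Prod>j\<in>{1..n}. f' j (X j))" .
  qed
  \<comment> \<open>Independence of the values; the bounds on \<open>f'\<close> supply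
    integrability.\<close>
  also have "\<dots> = (\<Prod>j\<in>{1..n}. measure_pmf.expectation (F j) (f' j))"
    using f'_bounds
    by (intro expectation_prod_Pi_pmf measure_pmf.integrable_const_bound[where B = 1]) auto
  also have "\<dots> = (\<Prod>u\<in>{1..n}. measure_pmf.expectation (F (\<pi> u)) (f u))"
    using prod.permute[OF perm, of "\<lambda>j. measure_pmf.expectation (F j) (f' j)"]
    by (simp add: f'_\<pi> o_def)
  also have "\<dots> = (\<Prod>u\<in>{1..<t}. measure_pmf.expectation (F (\<pi> u)) (f u)) *
      measure_pmf.expectation (F (\<pi> t)) (f t)"
    by (rule prod_f) (simp add: f_def)
  also have "(\<Prod>u\<in>{1..<t}. measure_pmf.expectation (F (\<pi> u)) (f u)) = (\<Prod>u\<in>{1..<t}. 1 - r u / s u)"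
  proof (intro prod.cong refl)
    fix u assume "u \<in> {1..<t}"
    then have "f u = (\<lambda>y. 1 - q y / s u)"
      by (auto simp: f_def a_def)
    then show "measure_pmf.expectation (F (\<pi> u)) (f u) = 1 - r u / s u"
      using int_q by (simp add: r_def)
  qed
  also have "\<dots> = s t"
    using t by (intro telescope) auto
  also have "measure_pmf.expectation (F (\<pi> t)) (f t) = pmf (F i) x * (q x / s t)"
  proof -
    have "measure_pmf.expectation (F (\<pi> t)) (f t) =
        measure_pmf.expectation (F i) (\<lambda>y. indicator {x} y * (q x / s t))"
      unfolding t(2) by (intro Bochner_Integration.integral_cong) (auto simp: f_def a_def indicator_def)
    then show ?thesis by (simp add: measure_pmf_single)
  qed
  also have "s t * (pmf (F i) x * (q x / s t)) = pmf (F i) x * q x"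
    using s_ge[of t] t by auto
  finally show "measure_pmf.prob ?J {(X, h). h = Some i \<and> X i = x} = pmf (F i) x * q x" .
qed

section \<open>Half of any offline IIF value is attained online\<close>

text \<open>Halving the probability function halves the value exactly, by linearity, and brings the
  total hiring probability down to at most \<open>1/2\<close>, which is the condition under which a
  stopping rule realises it.\<close>

lemma online_IIF_half:
  assumes "hiring_instance n F \<pi>" "offline_algorithm n A" "IIF n F A"
  obtains d where "IIF n F (online_algorithm n \<pi> d)"
    "expected_value n F (online_algorithm n \<pi> d) = 1 / 2 * expected_value n F A"
proof -
  have perm: "\<pi> permutes {1..n}"
    using assms(1) by (simp add: hiring_instance_def)
  obtain p where p: "IIF_with n F A p"
    using assms(3) by (auto simp: IIF_def)
  note hire = IIF_with_prob_hire[OF p]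
  \<comment> \<open>IIF controls \<open>p\<close> only on \<open>value_set n F\<close>. The default
    \<open>0\<close> elsewhere makes the bound by \<open>1/2\<close> hold for all reals, as
    \<open>online_hire_prob\<close> requires.\<close>
  define q where "q x = (if x \<in> value_set n F then p x / 2 else 0)" for x
  have q: "q x \<in> {0..1/2}" for x
    using p by (auto simp: q_def IIF_with_def)
  have q_eq: "ennreal (q x) = 1 / 2 * ennreal (p x)"
    if i: "i \<in> {1..n}" and x: "x \<in> set_pmf (F i)" for i x
  proof -
    have "x \<in> value_set n F"
      using i x by (auto simp: value_set_def intro: pmf_positive)
    then have "q x = p x / 2" "p x \<ge> 0"
      using p by (auto simp: q_def IIF_with_def)
    then show ?thesis
      using divide_ennreal[of "p x" 2] by (simp add: ennreal_divide_times)
  qed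
  \<comment> \<open>Used with the constant \<open>1\<close> for the total hiring probability and
    with \<open>ennreal\<close> for the value.\<close>
  have scaled: "(\<Sum>i\<in>{1..n}. \<integral>\<^sup>+ x. ennreal (q x) * g x \<partial>measure_pmf (F i)) =
      1 / 2 * (\<Sum>i\<in>{1..n}. \<integral>\<^sup>+ x. ennreal (p x) * g x \<partial>measure_pmf (F i))"
    for g :: "real \<Rightarrow> ennreal"
  proof -
    have "(\<integral>\<^sup>+ x. ennreal (q x) * g x \<partial>measure_pmf (F i)) =
        1 / 2 * (\<integral>\<^sup>+ x. ennreal (p x) * g x \<partial>measure_pmf (F i))" if "i \<in> {1..n}" for i
      by (subst nn_integral_cmult[symmetric], simp)
         (intro nn_integral_cong_AE AE_pmfI, simp add: q_eq[OF that] mult.assoc)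
    then show ?thesis
      by (simp add: sum_distrib_left)
  qed
  have "ennreal (\<Sum>i\<in>{1..n}. measure_pmf.expectation (F i) q) =
      (\<Sum>i\<in>{1..n}. \<integral>\<^sup>+ x. ennreal (q x) \<partial>measure_pmf (F i))"
  proof -
    have "(\<integral>\<^sup>+ x. ennreal (q x) \<partial>measure_pmf (F i)) = ennreal (measure_pmf.expectation (F i) q)" for i
      using q
      by (intro nn_integral_eq_integral measure_pmf.integrable_const_bound[where B = "1/2"]) auto
    moreover have "measure_pmf.expectation (F i) q \<ge> 0" for i
      using q by (intro integral_nonneg_AE) auto
    ultimately show ?thesis by (simp add: sum_ennreal)
  qed
  also have "\<dots> \<le> 1 / 2"
    using scaled[of "\<lambda>_. 1"] sum_hire_prob_le_1[OF hire]
    using mult_left_mono[of _ 1 "1 / 2 :: ennreal"] unfolding mult_1_right by simp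
  also have "\<dots> = ennreal (1 / 2)"
    using divide_ennreal[of 1 2] by simp
  finally have "(\<Sum>i\<in>{1..n}. measure_pmf.expectation (F i) q) \<le> 1 / 2"
    by (subst (asm) ennreal_le_iff) auto
  from online_hire_prob[of \<pi> n q F, OF perm q this]
  obtain d where d: "\<And>i x. i \<in> {1..n} \<Longrightarrow>
      measure_pmf.prob (joint n F (online_algorithm n \<pi> d)) {(X, h). h = Some i \<and> X i = x} =
        pmf (F i) x * q x"
    by blast
  show thesis
  proof
    have "q x \<le> 1" for x using q[of x] by auto
    then have "IIF_with n F (online_algorithm n \<pi> d) q"
      using q unfolding IIF_with_def by (auto simp: cond_prob_hire d)
    then show "IIF n F (online_algorithm n \<pi> d)"
      by (auto simp: IIF_def)
    show "expected_value n F (online_algorithm n \<pi> d) = 1 / 2 * expected_value n F A"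
      using expected_value_eq_sum[OF offline_algorithm_online[OF perm] d]
        expected_value_eq_sum[OF assms(2) hire] scaled[of ennreal] by simp
  qed
qed

section \<open>The tight two-candidate instance\<close>

text \<open>For \<open>0 < \<epsilon> < 1\<close> both candidates have mean \<open>1\<close>, so
  giving up the first for the second gains nothing on average, whereas their maximum has mean
  \<open>2 - \<epsilon>\<close>.\<close>

definition tight_dist :: "real \<Rightarrow> nat \<Rightarrow> real pmf" where
  "tight_dist \<epsilon> i = (if i = 1 then return_pmf 1
     else map_pmf (\<lambda>b. if b then 1 / \<epsilon> else 0) (bernoulli_pmf \<epsilon>))"

text \<open>One coin determines the whole profile, so expectations reduce to two cases. The value
  \<open>0\<close> outside \<open>{1, 2}\<close> agrees with the default of
  \<open>Pi_pmf\<close>.\<close>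

definition tight_profile :: "real \<Rightarrow> bool \<Rightarrow> profile" where
  "tight_profile \<epsilon> b = (\<lambda>_. 0)(2 := if b then 1 / \<epsilon> else 0, 1 := 1)"

lemma tight_profile_simps [simp]:
  "tight_profile \<epsilon> b (Suc 0) = 1" "tight_profile \<epsilon> b 2 = (if b then 1 / \<epsilon> else 0)"
  by (simp_all add: tight_profile_def)

lemma Pi_pmf_tight:
  "Pi_pmf {1..2} 0 (tight_dist \<epsilon>) = map_pmf (tight_profile \<epsilon>) (bernoulli_pmf \<epsilon>)"
proof -
  have "{1..2} = insert 1 {2 :: nat}" by auto
  then show ?thesis
    by (simp add: Pi_pmf_insert Pi_pmf_singleton tight_dist_def pair_return_pmf1 pmf.map_comp o_def)
       (auto simp: tight_profile_def fun_eq_iff intro!: map_pmf_cong)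
qed

lemma joint_tight:
  "joint 2 (tight_dist \<epsilon>) A = bind_pmf (bernoulli_pmf \<epsilon>)
     (\<lambda>b. map_pmf (\<lambda>h. (tight_profile \<epsilon> b, h)) (A (tight_profile \<epsilon> b)))"
  unfolding joint_def Pi_pmf_tight by (simp add: bind_map_pmf)

lemma nn_integral_joint_tight:
  assumes "0 \<le> \<epsilon>" "\<epsilon> \<le> 1"
  shows "(\<integral>\<^sup>+ z. f z \<partial>measure_pmf (joint 2 (tight_dist \<epsilon>) A)) =
    (\<integral>\<^sup>+ h. f (tight_profile \<epsilon> True, h) \<partial>A (tight_profile \<epsilon> True)) * ennreal \<epsilon> +
    (\<integral>\<^sup>+ h. f (tight_profile \<epsilon> False, h) \<partial>A (tight_profile \<epsilon> False)) * ennreal (1 - \<epsilon>)"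
  using assms by (simp add: joint_tight)

lemma prob_joint_tight:
  assumes "0 \<le> \<epsilon>" "\<epsilon> \<le> 1" "\<And>X. A X = return_pmf (g X)"
  shows "measure_pmf.prob (joint 2 (tight_dist \<epsilon>) A) S =
    indicator S (tight_profile \<epsilon> True, g (tight_profile \<epsilon> True)) * \<epsilon> +
    indicator S (tight_profile \<epsilon> False, g (tight_profile \<epsilon> False)) * (1 - \<epsilon>)"
proof -
  let ?z = "\<lambda>b. (tight_profile \<epsilon> b, g (tight_profile \<epsilon> b))"
  have "joint 2 (tight_dist \<epsilon>) A = map_pmf ?z (bernoulli_pmf \<epsilon>)"
    by (simp add: joint_tight assms(3) map_pmf_def bind_return_pmf)
  then have "measure_pmf.prob (joint 2 (tight_dist \<epsilon>) A) S =
      measure_pmf.expectation (bernoulli_pmf \<epsilon>) (indicator (?z -` S))"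
    by simp
  then show ?thesis
    using assms(1,2) by (simp del: Bochner_Integration.integral_indicator add: indicator_def of_bool_def)
qed

text \<open>The supports \<open>{1}\<close> and \<open>{0, 1 / \<epsilon>}\<close> are disjoint, so
  no value is shared by the two candidates and \<open>p\<close> can simply record the conditional
  hiring probabilities. Both optimal algorithms below get their IIF property from here.\<close>

lemma IIF_tight:
  assumes \<epsilon>: "0 < \<epsilon>" "\<epsilon> < 1" and A: "\<And>X. A X = return_pmf (g X)"
    and no: "g (tight_profile \<epsilon> False) = Some 1"
    and yes: "g (tight_profile \<epsilon> True) \<in> {Some 1, Some 2}"
  shows "IIF 2 (tight_dist \<epsilon>) A"
  unfolding IIF_def
proof
  \<comment> \<open>If candidate 1 is hired for both coin outcomes, its value \<open>1\<close> has
    probability \<open>1\<close>. Otherwise it is hired only when the coin is \<open>False\<close>,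
    hence \<open>1 - \<epsilon>\<close>, and \<open>1 / \<epsilon>\<close> is always hired. The
    value \<open>0\<close> is never hired.\<close>
  define p where "p x = (if g (tight_profile \<epsilon> True) = Some 1 then if x = 1 then 1 else 0
      else if x = 1 then 1 - \<epsilon> else if x = 1 / \<epsilon> then 1 else 0)" for x :: real
  have pmf_2: "pmf (tight_dist \<epsilon> 2) x =
      (if x = 1 / \<epsilon> then \<epsilon> else if x = 0 then 1 - \<epsilon> else 0)" for x
    using \<epsilon> by (simp add: tight_dist_def map_pmf_def pmf_bind)
  have pmf_1: "pmf (tight_dist \<epsilon> 1) x = indicator {1} x" for x
    by (simp add: tight_dist_def pmf_return indicator_def)
  have prob: "measure_pmf.prob (joint 2 (tight_dist \<epsilon>) A) {(X, h). h = Some i \<and> X i = x} =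
      (if g (tight_profile \<epsilon> True) = Some i \<and> tight_profile \<epsilon> True i = x then \<epsilon> else 0) +
      (if Some 1 = Some i \<and> tight_profile \<epsilon> False i = x then 1 - \<epsilon> else 0)" for i x
    using \<epsilon> no by (simp add: prob_joint_tight[OF _ _ A] indicator_def)
  have prob_1: "measure_pmf.prob (joint 2 (tight_dist \<epsilon>) A) {(X, h). h = Some 1 \<and> X 1 = 1} = p 1"
    unfolding prob p_def using yes by auto
  have prob_2: "measure_pmf.prob (joint 2 (tight_dist \<epsilon>) A) {(X, h). h = Some 2 \<and> X 2 = 1 / \<epsilon>} =
      \<epsilon> * p (1 / \<epsilon>)"
    unfolding prob p_def using yes \<epsilon> by auto
  have prob_0: "measure_pmf.prob (joint 2 (tight_dist \<epsilon>) A) {(X, h). h = Some 2 \<and> X 2 = 0} = 0"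
    unfolding prob using \<epsilon> by auto
  have "p 0 = 0"
    using \<epsilon> by (simp add: p_def)
  have cond: "\<P>((X, h) in measure_pmf (joint 2 (tight_dist \<epsilon>) A). h = Some i \<bar> X i = x) = p x"
    if i: "i \<in> {1..2}" and x: "pmf (tight_dist \<epsilon> i) x > 0" for i x
  proof -
    have "i = 1 \<or> i = 2" using i by auto
    then have "i = 1 \<and> x = 1 \<or> i = 2 \<and> x = 1 / \<epsilon> \<or> i = 2 \<and> x = 0"
    proof
      assume "i = 1"
      with x have "indicator {1} x > (0 :: real)" by (simp only: pmf_1)
      with \<open>i = 1\<close> show ?thesis by (simp add: indicator_def split: if_splits)
    next
      assume "i = 2"
      with x show ?thesis by (simp add: pmf_2 split: if_splits)
    qed
    then have "measure_pmf.prob (joint 2 (tight_dist \<epsilon>) A) {(X, h). h = Some i \<and> X i = x} =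
        pmf (tight_dist \<epsilon> i) x * p x"
    proof (elim disjE conjE)
      assume "i = 1" "x = 1"
      show ?thesis unfolding \<open>i = 1\<close> \<open>x = 1\<close> prob_1 pmf_1 by simp
    next
      assume "i = 2" "x = 1 / \<epsilon>"
      show ?thesis unfolding \<open>i = 2\<close> \<open>x = 1 / \<epsilon>\<close> prob_2 pmf_2 by simp
    next
      assume "i = 2" "x = 0"
      show ?thesis unfolding \<open>i = 2\<close> \<open>x = 0\<close> prob_0 \<open>p 0 = 0\<close> by simp
    qed
    with x show ?thesis
      unfolding cond_prob_hire[OF i] by simp
  qed
  have "p x \<in> {0..1}" for x
    using \<epsilon> by (simp add: p_def)
  with cond show "IIF_with 2 (tight_dist \<epsilon>) A p"
    unfolding IIF_with_def by blast
qed

lemma hired_value_tight_le: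
  assumes "0 < \<epsilon>" "\<epsilon> < 1" "h \<in> insert None (Some ` {1..2})"
  shows "hired_value (tight_profile \<epsilon> b) h \<le> (if b then 1 / \<epsilon> else 1)"
proof -
  have "{1..2} = {Suc 0, 2}" by auto
  then show ?thesis
    using assms by auto
qed

text \<open>Hiring the larger value is best on each of the two profiles: it earns
  \<open>1 / \<epsilon>\<close> with probability \<open>\<epsilon>\<close> and \<open>1\<close> with
  probability \<open>1 - \<epsilon>\<close>.\<close>

lemma optimal_offline_tight:
  assumes \<epsilon>: "0 < \<epsilon>" "\<epsilon> < 1"
  obtains A where "optimal_offline_IIF 2 (tight_dist \<epsilon>) A"
    "expected_value 2 (tight_dist \<epsilon>) A = ennreal (2 - \<epsilon>)"
proof
  define g where "g X = (if X 2 = 1 / \<epsilon> then Some 2 else Some (1 :: nat))" for X :: profile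
  define A where "A X = return_pmf (g X)" for X
  have sum: "ennreal (1 / \<epsilon>) * ennreal \<epsilon> + ennreal 1 * ennreal (1 - \<epsilon>) = ennreal (2 - \<epsilon>)"
    using \<epsilon> by (simp flip: ennreal_mult' ennreal_plus del: ennreal_1)
  have value_A: "expected_value 2 (tight_dist \<epsilon>) A = ennreal (2 - \<epsilon>)"
    using \<epsilon> sum by (simp add: expected_value_def nn_integral_joint_tight A_def g_def)
  moreover have "expected_value 2 (tight_dist \<epsilon>) B \<le> ennreal (2 - \<epsilon>)" if B: "offline_algorithm 2 B" for B
  proof -
    have bound: "(\<integral>\<^sup>+ h. ennreal (hired_value (tight_profile \<epsilon> b) h) \<partial>B (tight_profile \<epsilon> b))
        \<le> ennreal (if b then 1 / \<epsilon> else 1)" for b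
    proof -
      have "(\<integral>\<^sup>+ h. ennreal (hired_value (tight_profile \<epsilon> b) h) \<partial>B (tight_profile \<epsilon> b))
          \<le> (\<integral>\<^sup>+ h. ennreal (if b then 1 / \<epsilon> else 1) \<partial>B (tight_profile \<epsilon> b))"
        using B \<epsilon> unfolding offline_algorithm_def
        by (intro nn_integral_mono_AE AE_pmfI ennreal_leI hired_value_tight_le) blast+
      then show ?thesis by simp
    qed
    have "expected_value 2 (tight_dist \<epsilon>) B \<le>
        ennreal (1 / \<epsilon>) * ennreal \<epsilon> + ennreal 1 * ennreal (1 - \<epsilon>)"
      using \<epsilon> add_mono[OF mult_right_mono[OF bound[of True]] mult_right_mono[OF bound[of False]]]
      by (simp add: expected_value_def nn_integral_joint_tight)
    with sum show ?thesis by simp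
  qed
  moreover have "offline_algorithm 2 A"
    by (auto simp: offline_algorithm_def A_def g_def)
  moreover have "IIF 2 (tight_dist \<epsilon>) A"
    using \<epsilon> by (intro IIF_tight[where g = g]) (auto simp: A_def g_def)
  ultimately show "optimal_offline_IIF 2 (tight_dist \<epsilon>) A"
    by (simp add: optimal_offline_IIF_def)
  show "expected_value 2 (tight_dist \<epsilon>) A = ennreal (2 - \<epsilon>)"
    by (rule value_A)
qed

text \<open>The first value carries no information about the second. A rule that accepts it with
  probability \<open>a\<close> earns \<open>a\<close>, plus at most the mean \<open>1\<close> of the
  second candidate with probability \<open>1 - a\<close>.\<close>

lemma expected_value_online_tight_le_1:
  assumes \<epsilon>: "0 < \<epsilon>" "\<epsilon> < 1"
  shows "expected_value 2 (tight_dist \<epsilon>) (online_algorithm 2 id e) \<le> 1"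
proof -
  \<comment> \<open>The first history is \<open>[1]\<close> on every profile, so the first decision
    is a single coin with bias \<open>a\<close>, the same for both outcomes
    \<open>b\<close>.\<close>
  define a where "a = pmf (e [1]) True"
  have a: "0 \<le> a" "a \<le> 1"
    by (simp_all add: a_def pmf_le_1)
  have e1: "e [1] = bernoulli_pmf a"
  proof (rule pmf_eqI)
    fix b
    show "pmf (e [1]) b = pmf (bernoulli_pmf a) b"
      using a by (cases b) (simp_all add: a_def pmf_False_conv_True)
  qed
  have upt: "map id [1..<Suc 2] = [1, 2 :: nat]"
    by (simp add: upt_rec)
  have run: "(\<integral>\<^sup>+ h. ennreal (hired_value (tight_profile \<epsilon> b) h)
      \<partial>online_algorithm 2 id e (tight_profile \<epsilon> b))
      \<le> ennreal (a + (if b then (1 - a) / \<epsilon> else 0))" for b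
  proof -
    let ?y = "if b then 1 / \<epsilon> else 0 :: real"
    let ?V = "\<lambda>h. ennreal (hired_value (tight_profile \<epsilon> b) h)"
    \<comment> \<open>After a rejection only candidate 2 can be hired, so \<open>?y\<close> bounds
      the gain whatever the rule then decides.\<close>
    have "(\<integral>\<^sup>+ h. ?V h \<partial>run_rule e (tight_profile \<epsilon> b) [1] [2]) \<le>
        (\<integral>\<^sup>+ h. ennreal ?y \<partial>run_rule e (tight_profile \<epsilon> b) [1] [2])"
    proof (intro nn_integral_mono_AE AE_pmfI ennreal_leI)
      fix h assume "h \<in> set_pmf (run_rule e (tight_profile \<epsilon> b) [1] [2])"
      then have "h \<in> insert None (Some ` set [2])"
        using set_pmf_run_rule by blast
      then show "hired_value (tight_profile \<epsilon> b) h \<le> ?y"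
        using \<epsilon> by auto
    qed
    then have second: "(\<integral>\<^sup>+ h. ?V h \<partial>run_rule e (tight_profile \<epsilon> b) [1] [2]) \<le> ennreal ?y"
      by simp
    have "online_algorithm 2 id e (tight_profile \<epsilon> b) = bind_pmf (bernoulli_pmf a)
        (\<lambda>hire. if hire then return_pmf (Some 1) else run_rule e (tight_profile \<epsilon> b) [1] [2])"
      unfolding online_algorithm_def upt by (subst run_rule.simps) (simp only: append_Nil One_nat_def tight_profile_simps e1)
    then have "(\<integral>\<^sup>+ h. ?V h \<partial>online_algorithm 2 id e (tight_profile \<epsilon> b)) =
        ennreal a + (\<integral>\<^sup>+ h. ?V h \<partial>run_rule e (tight_profile \<epsilon> b) [1] [2]) * ennreal (1 - a)"
      using a by (simp del: run_rule.simps)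
    also have "\<dots> \<le> ennreal a + ennreal ?y * ennreal (1 - a)"
      by (intro add_left_mono mult_right_mono second) simp
    also have "\<dots> = ennreal (a + (if b then (1 - a) / \<epsilon> else 0))"
      using a \<epsilon> by (simp flip: ennreal_mult' ennreal_plus)
    finally show ?thesis .
  qed
  have "expected_value 2 (tight_dist \<epsilon>) (online_algorithm 2 id e) \<le>
      ennreal (a + (1 - a) / \<epsilon>) * ennreal \<epsilon> + ennreal a * ennreal (1 - \<epsilon>)"
    using \<epsilon> add_mono[OF mult_right_mono[OF run[of True]] mult_right_mono[OF run[of False]]]
    by (simp add: expected_value_def nn_integral_joint_tight)
  also have "\<dots> = ennreal ((a + (1 - a) / \<epsilon>) * \<epsilon> + a * (1 - \<epsilon>))"
    using \<epsilon> a by (simp flip: ennreal_mult' ennreal_plus)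
  also have "(a + (1 - a) / \<epsilon>) * \<epsilon> + a * (1 - \<epsilon>) = 1"
    using \<epsilon> by (simp add: field_simps)
  finally show ?thesis unfolding ennreal_1 .
qed

text \<open>Hiring the first arrival at once attains the upper bound \<open>1\<close>.\<close>

lemma optimal_online_tight:
  assumes \<epsilon>: "0 < \<epsilon>" "\<epsilon> < 1"
  obtains d where "optimal_online_IIF 2 (tight_dist \<epsilon>) id d"
    "expected_value 2 (tight_dist \<epsilon>) (online_algorithm 2 id d) = 1"
proof
  let ?A = "online_algorithm 2 id (\<lambda>_. return_pmf True)"
  have A: "?A X = return_pmf (Some 1)" for X
    by (simp add: online_algorithm_def upt_rec bind_return_pmf)
  have value_A: "expected_value 2 (tight_dist \<epsilon>) ?A = 1"
    using \<epsilon> by (simp add: expected_value_def nn_integral_joint_tight A flip: ennreal_plus)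
  moreover have "IIF 2 (tight_dist \<epsilon>) ?A"
    by (rule IIF_tight[OF \<epsilon> A]) auto
  ultimately show "optimal_online_IIF 2 (tight_dist \<epsilon>) id (\<lambda>_. return_pmf True)"
    using expected_value_online_tight_le_1[OF \<epsilon>] by (simp add: optimal_online_IIF_def)
  show "expected_value 2 (tight_dist \<epsilon>) ?A = 1"
    by (rule value_A)
qed

theorem mainTheorem10:
  "(\<forall>n F \<pi> OPTOff OPTOn.
      hiring_instance n F \<pi> \<longrightarrow>
      optimal_offline_IIF n F OPTOff \<longrightarrow>
      optimal_online_IIF n F \<pi> OPTOn \<longrightarrow>
      expected_value n F (online_algorithm n \<pi> OPTOn) \<ge> 1 / 2 * expected_value n F OPTOff)
   \<and>
   (\<forall>c::real. c > 1 / 2 \<longrightarrow>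
      (\<exists>n F \<pi> OPTOff OPTOn.
         hiring_instance n F \<pi> \<and>
         optimal_offline_IIF n F OPTOff \<and>
         optimal_online_IIF n F \<pi> OPTOn \<and>
         expected_value n F (online_algorithm n \<pi> OPTOn) < ennreal c * expected_value n F OPTOff))"
proof (intro conjI allI impI)
  fix n F \<pi> OPTOff OPTOn
  assume *: "hiring_instance n F \<pi>" "optimal_offline_IIF n F OPTOff" "optimal_online_IIF n F \<pi> OPTOn"
  \<comment> \<open>The halved version of \<open>OPTOff\<close> is an IIF stopping rule, hence a
    competitor that \<open>OPTOn\<close> must match.\<close>
  then obtain d where "IIF n F (online_algorithm n \<pi> d)"
      "expected_value n F (online_algorithm n \<pi> d) = 1 / 2 * expected_value n F OPTOff"
    using online_IIF_half[of n F \<pi> OPTOff] unfolding optimal_offline_IIF_def by blast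
  with *(3) show "expected_value n F (online_algorithm n \<pi> OPTOn) \<ge> 1 / 2 * expected_value n F OPTOff"
    unfolding optimal_online_IIF_def by metis
next
  fix c :: real
  assume c: "c > 1 / 2"
  \<comment> \<open>chosen such that \<open>c * (2 - \<epsilon>) = c + 1 / 2\<close>\<close>
  define \<epsilon> where "\<epsilon> = 1 - 1 / (2 * c)"
  have \<epsilon>: "0 < \<epsilon>" "\<epsilon> < 1"
    using c by (auto simp: \<epsilon>_def field_simps)
  obtain A where A: "optimal_offline_IIF 2 (tight_dist \<epsilon>) A"
      "expected_value 2 (tight_dist \<epsilon>) A = ennreal (2 - \<epsilon>)"
    using optimal_offline_tight[OF \<epsilon>] .
  obtain d where d: "optimal_online_IIF 2 (tight_dist \<epsilon>) id d"
      "expected_value 2 (tight_dist \<epsilon>) (online_algorithm 2 id d) = 1"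
    using optimal_online_tight[OF \<epsilon>] .
  have "hiring_instance 2 (tight_dist \<epsilon>) id"
    using \<epsilon> by (auto simp: hiring_instance_def tight_dist_def permutes_id)
  moreover have "1 < ennreal c * ennreal (2 - \<epsilon>)"
  proof -
    have "1 < c * (2 - \<epsilon>)"
      using c by (simp add: \<epsilon>_def field_simps)
    then have "ennreal 1 < ennreal (c * (2 - \<epsilon>))"
      by (intro ennreal_lessI) auto
    then show ?thesis
      using c by (simp add: ennreal_mult')
  qed
  ultimately show "\<exists>n F \<pi> OPTOff OPTOn.
         hiring_instance n F \<pi> \<and>
         optimal_offline_IIF n F OPTOff \<and>
         optimal_online_IIF n F \<pi> OPTOn \<and>
         expected_value n F (online_algorithm n \<pi> OPTOn) < ennreal c * expected_value n F OPTOff"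
    using A d by metis
qed

end
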